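(* Let $G$ be a non-discrete metric group. Then for every function $f:\mathbb N\to\mathbb N\setminus\{0\}$ the group $G$ contains an unconditionally $f$-Cauchy productive sequence.
   Context: All topological groups are Hausdorff; $\mathbb N=\{0,1,2,\dots\}$. A metric group is a metrizable topological group. A sequence $\{x_n:n\in\mathbb N\}$ in a topological group $G$ is left Cauchy if for every neighbourhood $U$ of the identity there is $k\in\mathbb N$ with $x_l^{-1}x_m\in U$ for all $l,m\ge k$. Products are ordered: $\prod_{n=0}^m b_n=b_0b_1\cdots b_m$. A sequence $\{b_n:n\in\mathbb N\}$ in $G$ is Cauchy productive if the sequence $\{\prod_{n=0}^m b_n:m\in\mathbb N\}$ is left Cauchy. For $f:\mathbb N\to\mathbb N\setminus\{0\}$, a sequence $\{a_n:n\in\mathbb N\}$ of elements of $G$ is $f$-Cauchy productive if it is faithfully indexed ($a_n\ne a_m$ for $n\neq m$) and $\{a_n^{z(n)}:n\in\mathbb N\}$ is Cauchy productive for every $z:\mathbb N\to\mathbb Z$ with $|z(n)|\le f(n)$ for all $n\in\mathbb N$. It is unconditionally $f$-Cauchy productive if it is faithfully indexed and $\{a_{\varphi(n)}:n\in\mathbb N\}$ is $(f\circ\varphi)$-Cauchy productive for every bijection $\varphi:\mathbb N\to\mathbb N$. *)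

theory Defs
  imports "HOL-Algebra.Group" "HOL-Analysis.Analysis"
begin

locale hausdorff_topological_group = group G
  for G :: "('a, 'b) monoid_scheme" (structure) and T :: "'a topology" +
  assumes topspace_eq: "topspace T = carrier G"
    and continuous_mult: "continuous_map (prod_topology T T) T (\<lambda>(x, y). x \<otimes> y)"
    and continuous_inv: "continuous_map T T (\<lambda>x. inv\<^bsub>G\<^esub> x)"
    and hausdorff: "Hausdorff_space T"

locale metric_group = hausdorff_topological_group +
  assumes metrizable: "metrizable_space T"

text \<open>The neighbourhoods of a point are the sets, open or not, having it in their interior.\<close>

definition left_Cauchy ::
    "('a, 'b) monoid_scheme \<Rightarrow> 'a topology \<Rightarrow> (nat \<Rightarrow> 'a) \<Rightarrow> bool" where
  "left_Cauchy G T x \<longleftrightarrow>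
     range x \<subseteq> carrier G \<and>
     (\<forall>U. \<one>\<^bsub>G\<^esub> \<in> T interior_of U \<longrightarrow>
        (\<exists>k. \<forall>l\<ge>k. \<forall>m\<ge>k. inv\<^bsub>G\<^esub> (x l) \<otimes>\<^bsub>G\<^esub> x m \<in> U))"

text \<open>\<open>ordered_prod G b m\<close> is the product of \<open>b 0, \<dots>, b m\<close> in this order, the
  last index included.\<close>

primrec ordered_prod ::
    "('a, 'b) monoid_scheme \<Rightarrow> (nat \<Rightarrow> 'a) \<Rightarrow> nat \<Rightarrow> 'a" where
  "ordered_prod G b 0 = b 0"
| "ordered_prod G b (Suc m) = ordered_prod G b m \<otimes>\<^bsub>G\<^esub> b (Suc m)"

definition Cauchy_productive ::
    "('a, 'b) monoid_scheme \<Rightarrow> 'a topology \<Rightarrow> (nat \<Rightarrow> 'a) \<Rightarrow> bool" where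
  "Cauchy_productive G T b \<longleftrightarrow>
     range b \<subseteq> carrier G \<and> left_Cauchy G T (ordered_prod G b)"

definition f_Cauchy_productive ::
    "('a, 'b) monoid_scheme \<Rightarrow> 'a topology \<Rightarrow> (nat \<Rightarrow> nat) \<Rightarrow> (nat \<Rightarrow> 'a) \<Rightarrow> bool" where
  "f_Cauchy_productive G T f a \<longleftrightarrow>
     range a \<subseteq> carrier G \<and> inj a \<and>
     (\<forall>z :: nat \<Rightarrow> int. (\<forall>n. \<bar>z n\<bar> \<le> int (f n)) \<longrightarrow>
        Cauchy_productive G T (\<lambda>n. a n [^]\<^bsub>G\<^esub> z n))"

definition unconditionally_f_Cauchy_productive ::
    "('a, 'b) monoid_scheme \<Rightarrow> 'a topology \<Rightarrow> (nat \<Rightarrow> nat) \<Rightarrow> (nat \<Rightarrow> 'a) \<Rightarrow> bool" where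
  "unconditionally_f_Cauchy_productive G T f a \<longleftrightarrow>
     range a \<subseteq> carrier G \<and> inj a \<and>
     (\<forall>\<phi> :: nat \<Rightarrow> nat. bij \<phi> \<longrightarrow> f_Cauchy_productive G T (f \<circ> \<phi>) (\<lambda>n. a (\<phi> n)))"

end

theory Submission imports Defs
begin

text \<open>A metrizable topology is first countable, so there are symmetric open
  neighbourhoods \<open>U n\<close> of the identity, shrinking to it, with \<open>U (n+1)\<^sup>3 \<subseteq> U n\<close>; choose pairwise
  distinct \<open>a n\<close> with \<open>a n\<^sup>j \<in> U n\<close> for \<open>\<bar>j\<bar> \<le> f n\<close>. A product of elements of sets \<open>U i\<close> with
  pairwise distinct \<open>i > N\<close>, taken in any order, lies in \<open>U N\<close>: split the product at the
  factor of smallest index \<open>p\<close>; by induction the parts to its left and right lie in \<open>U p\<close>, so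
  the whole lies in \<open>U p\<^sup>3 \<subseteq> U (p-1) \<subseteq> U N\<close>. As the order does not matter, this gives the
  Cauchy condition for all rearrangements.\<close>

text \<open>Greedy choice: an infinite set still has a point after the finitely many earlier choices
  are removed.\<close>

lemma exists_inj_choice:
  fixes W :: "nat \<Rightarrow> 'a set"
  assumes "\<And>n. infinite (W n)"
  obtains a where "inj a" "\<And>n. a n \<in> W n"
proof -
  have "\<exists>f. \<forall>n::nat. f n \<in> W n - f ` {..<n}"
  proof -
    have ex: "\<exists>r. r \<in> W n - h ` {..<n}" for n :: nat and h :: "nat \<Rightarrow> 'a"
      using assms[of n] by (metis Diff_infinite_finite finite.emptyI finite_imageI finite_lessThan all_not_in_conv)
    show ?thesis
      by (rule dependent_wellorder_choice[of "\<lambda>h n r. r \<in> W n - h ` {..<n}"]) (use ex in \<open>auto simp: image_iff Bex_def cong: conj_cong\<close>)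
  qed
  then obtain a where a: "\<And>n. a n \<in> W n - a ` {..<n}"
    by blast
  then have "a m \<noteq> a n" if "m < n" for m n
    using that by (metis DiffE imageI lessThan_iff)
  then have "inj a"
    by (metis injI linorder_neqE_nat)
  with a that show ?thesis
    by blast
qed

section \<open>Blocks of ordered products in an abstract group\<close>

context group
begin

lemma ordered_prod_closed:
  assumes "range b \<subseteq> carrier G"
  shows "ordered_prod G b m \<in> carrier G"
  using assms by (induction m) (auto simp: range_subsetD)

text \<open>The quotient \<open>inv (P l) \<otimes> P m\<close> is the block
  \<open>b (l+1) ... b m\<close>. The induction is on the block length, with \<open>N\<close>
  arbitrary: the two shorter blocks are placed in \<open>U (\<phi> p)\<close>, not merely in
  \<open>U N\<close>.\<close>

lemma inv_ordered_prod_mult_mem: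
  assumes U_carrier: "\<And>n. U n \<subseteq> carrier G" and one_mem: "\<And>n. \<one> \<in> U n"
    and U_triple: "\<And>n x y z. \<lbrakk>x \<in> U (Suc n); y \<in> U (Suc n); z \<in> U (Suc n)\<rbrakk> \<Longrightarrow> x \<otimes> y \<otimes> z \<in> U n"
    and b_mem: "\<And>n. b n \<in> U (\<phi> n)" and "inj \<phi>"
  shows "\<lbrakk>l \<le> m; \<And>n. \<lbrakk>l < n; n \<le> m\<rbrakk> \<Longrightarrow> N < \<phi> n\<rbrakk>
    \<Longrightarrow> inv (ordered_prod G b l) \<otimes> ordered_prod G b m \<in> U N"
proof (induction "m - l" arbitrary: l m N rule: less_induct)
  case less
  let ?P = "ordered_prod G b"
  have P: "?P n \<in> carrier G" for n
    using b_mem U_carrier by (intro ordered_prod_closed) blast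
  have b: "b n \<in> carrier G" for n
    using b_mem U_carrier by blast
  \<comment> \<open>Padding with identities: \<open>x = x \<otimes> \<one> \<otimes> \<one>\<close>
    is a triple product.\<close>
  have "U (Suc n) \<subseteq> U n" for n
  proof
    fix x assume "x \<in> U (Suc n)"
    then show "x \<in> U n"
      using U_triple[of x n \<one> \<one>] one_mem U_carrier[of "Suc n"] by auto
  qed
  then have mono: "U j \<subseteq> U i" if "i \<le> j" for i j
    using that by (rule lift_Suc_antimono_le)
  show ?case
  proof (cases "l = m")
    case True
    then show ?thesis
      using P one_mem by (simp add: l_inv)
  next
    case False
    then have "{l<..m} \<noteq> {}"
      using less.prems by simp
    then obtain p where p: "p \<in> {l<..m}" and min: "\<And>n. n \<in> {l<..m} \<Longrightarrow> \<phi> p \<le> \<phi> n"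
      using ex_is_arg_min_if_finite[of "{l<..m}" \<phi>] unfolding is_arg_min_linorder by blast
    \<comment> \<open>\<open>P q\<close> stops just before the factor \<open>b p\<close>, so the
      left block is \<open>b (l+1) ... b q\<close>; it is empty when \<open>q = l\<close>.\<close>
    then obtain q where q: "p = Suc q"
      by (cases p) auto
    \<comment> \<open>Injectivity makes the minimum strict, as the induction hypothesis needs with
      \<open>\<phi> p\<close> in place of \<open>N\<close>.\<close>
    have lt: "\<phi> p < \<phi> n" if "n \<in> {l<..m}" "n \<noteq> p" for n
      using min[OF that(1)] that(2) \<open>inj \<phi>\<close> by (metis injD le_neq_implies_less)
    have left: "inv (?P l) \<otimes> ?P q \<in> U (\<phi> p)"
      by (rule less.hyps) (use p q lt in auto)
    have right: "inv (?P p) \<otimes> ?P m \<in> U (\<phi> p)"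
      by (rule less.hyps) (use p lt in auto)
    have "N < \<phi> p"
      using p less.prems by auto
    then obtain r where r: "\<phi> p = Suc r" "N \<le> r"
      by (cases "\<phi> p") auto
    have "(inv (?P l) \<otimes> ?P q) \<otimes> b p \<otimes> (inv (?P p) \<otimes> ?P m) \<in> U r"
      using U_triple left right b_mem[of p] r by simp
    \<comment> \<open>Telescoping: \<open>P q \<otimes> b p = P p\<close>, which cancels against
      \<open>inv (P p)\<close>.\<close>
    moreover have "(inv (?P l) \<otimes> ?P q) \<otimes> b p \<otimes> (inv (?P p) \<otimes> ?P m) = inv (?P l) \<otimes> ?P m"
    proof -
      have "(inv (?P l) \<otimes> ?P q) \<otimes> b p \<otimes> (inv (?P p) \<otimes> ?P m)
          = inv (?P l) \<otimes> (?P p \<otimes> (inv (?P p) \<otimes> ?P m))"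
        using P b q by (simp add: m_assoc)
      also have "\<dots> = inv (?P l) \<otimes> ?P m"
        using P by (metis inv_closed m_assoc r_inv l_one)
      finally show ?thesis .
    qed
    ultimately show ?thesis
      using mono[OF r(2)] by auto
  qed
qed

end

section \<open>Continuity of powers and neighbourhoods of the identity\<close>

context hausdorff_topological_group
begin

lemma continuous_map_mult:
  assumes "continuous_map X T g" "continuous_map X T h"
  shows "continuous_map X T (\<lambda>x. g x \<otimes> h x)"
  using continuous_map_compose[OF continuous_map_pairedI[OF assms] continuous_mult]
  by (simp add: o_def)

lemma continuous_map_inv:
  "continuous_map X T g \<Longrightarrow> continuous_map X T (\<lambda>x. inv (g x))"
  using continuous_map_compose[OF _ continuous_inv] by (simp add: o_def)

lemma continuous_map_nat_pow: "continuous_map T T (\<lambda>x. x [^] (n::nat))"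
  by (induction n) (simp_all add: topspace_eq continuous_map_mult)

lemma continuous_map_int_pow: "continuous_map T T (\<lambda>x. x [^] (j::int))"
proof (cases "j < 0")
  case True
  then show ?thesis
    using continuous_map_inv[OF continuous_map_nat_pow[of "nat (- j)"]] by (simp only: int_pow_def2 if_True)
next
  case False
  then show ?thesis
    using continuous_map_nat_pow[of "nat j"] by (simp only: int_pow_def2 if_False)
qed

text \<open>Left translation by \<open>inv x\<close> is continuous and pulls \<open>{\<one>}\<close>
  back to \<open>{x}\<close>.\<close>

lemma openin_one_imp_discrete:
  assumes "openin T {\<one>}"
  shows "T = discrete_topology (carrier G)"
proof -
  have "openin T {x}" if x: "x \<in> carrier G" for x
  proof -
    have "continuous_map T T (\<lambda>y. inv x \<otimes> y)"
      using x by (intro continuous_map_mult) (auto simp: topspace_eq)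
    then have "openin T {y \<in> topspace T. inv x \<otimes> y \<in> {\<one>}}"
      using assms by (rule openin_continuous_map_preimage)
    moreover have "{y \<in> topspace T. inv x \<otimes> y \<in> {\<one>}} = {x}"
      using x inv_solve_left'[of \<one> x] by (auto simp: topspace_eq)
    ultimately show ?thesis
      by simp
  qed
  then show ?thesis
    using discrete_topology_unique[of "carrier G" T] topspace_eq by auto
qed

text \<open>Finite sets are closed in a Hausdorff space, so deleting the other points of a finite
  \<open>V\<close> would isolate the identity. This leaves room for a faithfully indexed
  choice.\<close>

lemma infinite_neighbourhood_one:
  assumes "T \<noteq> discrete_topology (carrier G)" "openin T V" "\<one> \<in> V"
  shows "infinite V"
proof
  assume fin: "finite V"
  have "closedin T (V - {\<one>})"
    using Hausdorff_imp_t1_space[OF hausdorff] fin openin_subset[OF assms(2)]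
    by (auto simp: t1_space_closedin_finite)
  then have "openin T (V - (V - {\<one>}))"
    using assms(2) by (rule openin_diff[rotated])
  moreover have "V - (V - {\<one>}) = {\<one>}"
    using assms(3) by blast
  ultimately show False
    using openin_one_imp_discrete assms(1) by auto
qed

lemma exists_symmetric_cube_root:
  assumes "openin T W" "\<one> \<in> W"
  obtains V where "openin T V" "\<one> \<in> V" "\<And>x. x \<in> V \<Longrightarrow> inv x \<in> V"
    "\<And>x y z. \<lbrakk>x \<in> V; y \<in> V; z \<in> V\<rbrakk> \<Longrightarrow> x \<otimes> y \<otimes> z \<in> W"
proof -
  have square: "\<exists>V. openin T V \<and> \<one> \<in> V \<and> (\<forall>x\<in>V. \<forall>y\<in>V. x \<otimes> y \<in> W)"
    if "openin T W" "\<one> \<in> W" for W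
  proof -
    let ?S = "{p \<in> topspace (prod_topology T T). (case p of (x, y) \<Rightarrow> x \<otimes> y) \<in> W}"
    have "openin (prod_topology T T) ?S"
      using continuous_mult that(1) by (rule openin_continuous_map_preimage)
    moreover have "(\<one>, \<one>) \<in> ?S"
      using that(2) by (simp add: topspace_eq)
    ultimately obtain A B where "openin T A" "openin T B" "\<one> \<in> A" "\<one> \<in> B" "A \<times> B \<subseteq> ?S"
      unfolding openin_prod_topology_alt by meson
    then show ?thesis
      by (intro exI[of _ "A \<inter> B"]) auto
  qed
  obtain A where A: "openin T A" "\<one> \<in> A" "\<And>x y. \<lbrakk>x \<in> A; y \<in> A\<rbrakk> \<Longrightarrow> x \<otimes> y \<in> W"
    using square[OF assms] by blast
  obtain B where B: "openin T B" "\<one> \<in> B" "\<And>x y. \<lbrakk>x \<in> B; y \<in> B\<rbrakk> \<Longrightarrow> x \<otimes> y \<in> A"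
    using square[OF A(1,2)] by blast
  \<comment> \<open>Intersecting \<open>B\<close> with its preimage under inversion makes it
    symmetric, since \<open>inv (inv x) = x\<close>.\<close>
  let ?C = "B \<inter> {x \<in> topspace T. inv x \<in> B}"
  have B_carrier: "B \<subseteq> carrier G"
    using openin_subset[OF B(1)] topspace_eq by simp
  have "x \<otimes> y \<otimes> z \<in> W" if "x \<in> B" "y \<in> B" "z \<in> B" for x y z
  proof -
    \<comment> \<open>Both \<open>x \<otimes> y\<close> and \<open>z = z \<otimes> \<one>\<close>
      lie in \<open>A\<close>, so one more multiplication lands in \<open>W\<close>.\<close>
    have "z \<otimes> \<one> \<in> A"
      using B that by blast
    then have "z \<in> A"
      using that B_carrier by auto
    then show ?thesis
      using A(3) B(3) that by blast
  qed
  moreover have "openin T ?C"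
    using B(1) continuous_inv by (blast intro: openin_Int openin_continuous_map_preimage)
  ultimately show ?thesis
    using B(2) B_carrier by (intro that[of ?C]) (auto simp: topspace_eq)
qed

text \<open>Only finitely many exponents are involved, so the preimages of \<open>W\<close> under
  the power maps have an open intersection.\<close>

lemma exists_neighbourhood_powers:
  assumes "openin T W" "\<one> \<in> W"
  obtains V where "openin T V" "\<one> \<in> V" "\<And>x j. \<lbrakk>x \<in> V; \<bar>j\<bar> \<le> int k\<rbrakk> \<Longrightarrow> x [^] j \<in> W"
proof
  let ?V = "\<Inter>j\<in>{- int k..int k}. {x \<in> topspace T. x [^] j \<in> W}"
  have "openin T {x \<in> topspace T. x [^] j \<in> W}" for j :: int
    using continuous_map_int_pow assms(1) by (rule openin_continuous_map_preimage)
  then show "openin T ?V"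
    by (intro openin_INT2) auto
  show "\<one> \<in> ?V"
    using assms(2) by (simp add: topspace_eq int_pow_one)
  show "x [^] j \<in> W" if "x \<in> ?V" "\<bar>j\<bar> \<le> int k" for x j
    using that by (auto simp: abs_le_iff)
qed

end

lemma countable_neighbourhood_base:
  assumes "first_countable X" "x \<in> topspace X"
  obtains B :: "nat \<Rightarrow> 'a set" where "\<And>n. openin X (B n)" "\<And>n. x \<in> B n"
    "\<And>W. \<lbrakk>openin X W; x \<in> W\<rbrakk> \<Longrightarrow> \<exists>n. B n \<subseteq> W"
proof -
  obtain \<B> where \<B>: "countable \<B>" "\<And>V. V \<in> \<B> \<Longrightarrow> openin X V"
    "\<And>W. \<lbrakk>openin X W; x \<in> W\<rbrakk> \<Longrightarrow> \<exists>V\<in>\<B>. x \<in> V \<and> V \<subseteq> W"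
    using assms unfolding first_countable_def by meson
  let ?C = "{V \<in> \<B>. x \<in> V}"
  \<comment> \<open>Enumerating \<open>?C\<close> by \<open>from_nat_into\<close> requires a member;
    applying the base property to the whole space yields one.\<close>
  have ne: "?C \<noteq> {}"
    using \<B>(3)[OF openin_topspace assms(2)] by blast
  moreover have "countable ?C"
    using \<B>(1) by simp
  ultimately have range: "range (from_nat_into ?C) = ?C"
    by (rule range_from_nat_into)
  have C: "from_nat_into ?C n \<in> ?C" for n
    using ne by (rule from_nat_into)
  show ?thesis
  proof (rule that[of "from_nat_into ?C"])
    show "openin X (from_nat_into ?C n)" "x \<in> from_nat_into ?C n" for n
      using C[of n] \<B>(2) by auto
    show "\<exists>n. from_nat_into ?C n \<subseteq> W" if W: "openin X W" "x \<in> W" for W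
    proof -
      obtain V where V: "V \<in> ?C" "V \<subseteq> W"
        using \<B>(3)[OF W] by blast
      have "V \<in> range (from_nat_into ?C)"
        using V(1) by (simp only: range)
      then obtain n where "V = from_nat_into ?C n" ..
      with V(2) show ?thesis
        by blast
    qed
  qed
qed

section \<open>Cubing bases and Cauchy productivity of rearrangements\<close>

context hausdorff_topological_group
begin

lemma exists_cubing_neighbourhood_base:
  assumes "first_countable T"
  obtains U :: "nat \<Rightarrow> 'a set" where
    "\<And>n. openin T (U n)" "\<And>n. \<one> \<in> U n" "\<And>n x. x \<in> U n \<Longrightarrow> inv x \<in> U n"
    "\<And>n x y z. \<lbrakk>x \<in> U (Suc n); y \<in> U (Suc n); z \<in> U (Suc n)\<rbrakk> \<Longrightarrow> x \<otimes> y \<otimes> z \<in> U n"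
    "\<And>W. \<lbrakk>openin T W; \<one> \<in> W\<rbrakk> \<Longrightarrow> \<exists>n. U n \<subseteq> W"
proof -
  obtain B :: "nat \<Rightarrow> 'a set" where B: "\<And>n. openin T (B n)" "\<And>n. \<one> \<in> B n"
    "\<And>W. \<lbrakk>openin T W; \<one> \<in> W\<rbrakk> \<Longrightarrow> \<exists>n. B n \<subseteq> W"
    using countable_neighbourhood_base[OF assms, of \<one>] topspace_eq by auto
  let ?good = "\<lambda>V. openin T V \<and> \<one> \<in> V \<and> (\<forall>x\<in>V. inv x \<in> V)"
  let ?cube = "\<lambda>V W. \<forall>x\<in>V. \<forall>y\<in>V. \<forall>z\<in>V. x \<otimes> y \<otimes> z \<in> W"
  \<comment> \<open>Recursive choice starting from the whole group. Cubing into
    \<open>U n \<inter> B n\<close>, not just \<open>U n\<close>, forces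
    \<open>U (Suc n) \<subseteq> B n\<close>, so the \<open>U n\<close> form a base at the
    identity.\<close>
  have "\<exists>U. \<forall>n. ?good (U n) \<and> ?cube (U (Suc n)) (U n \<inter> B n)"
  proof (rule dependent_nat_choice[of "\<lambda>_. ?good" "\<lambda>n W V. ?cube V (W \<inter> B n)"])
    show "\<exists>V. ?good V"
      using openin_topspace[of T] by (intro exI[of _ "carrier G"]) (auto simp: topspace_eq)
    show "\<exists>V. ?good V \<and> ?cube V (W \<inter> B n)" if "?good W" for W n
    proof -
      have "openin T (W \<inter> B n)" "\<one> \<in> W \<inter> B n"
        using that B by auto
      then show ?thesis
        by (rule exists_symmetric_cube_root) blast
    qed
  qed
  then obtain U where "\<forall>n. ?good (U n) \<and> ?cube (U (Suc n)) (U n \<inter> B n)" ..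
  then have U: "\<And>n. ?good (U n)"
    "\<And>n x y z. \<lbrakk>x \<in> U (Suc n); y \<in> U (Suc n); z \<in> U (Suc n)\<rbrakk> \<Longrightarrow> x \<otimes> y \<otimes> z \<in> U n \<inter> B n"
    by auto
  have "U (Suc n) \<subseteq> B n" for n
  proof
    fix x assume x: "x \<in> U (Suc n)"
    then have "x \<in> carrier G"
      using U(1) openin_subset topspace_eq by blast
    then show "x \<in> B n"
      using U(2)[of x n \<one> \<one>] x U(1) by auto
  qed
  then have "\<exists>n. U n \<subseteq> W" if "openin T W" "\<one> \<in> W" for W
    using B(3)[OF that] by (meson subset_trans)
  with U show ?thesis
    by (intro that[of U]) auto
qed

text \<open>Here \<open>\<phi>\<close> records which neighbourhood controls each factor; being
  injective, it eventually exceeds any \<open>N\<close>, so late blocks lie in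
  \<open>U N\<close>.\<close>

lemma Cauchy_productive_rearrangement:
  assumes U_open: "\<And>n. openin T (U n)" and one_mem: "\<And>n. \<one> \<in> U n"
    and U_inv: "\<And>n x. x \<in> U n \<Longrightarrow> inv x \<in> U n"
    and U_triple: "\<And>n x y z. \<lbrakk>x \<in> U (Suc n); y \<in> U (Suc n); z \<in> U (Suc n)\<rbrakk> \<Longrightarrow> x \<otimes> y \<otimes> z \<in> U n"
    and U_base: "\<And>W. \<lbrakk>openin T W; \<one> \<in> W\<rbrakk> \<Longrightarrow> \<exists>n. U n \<subseteq> W"
    and b_mem: "\<And>n. b n \<in> U (\<phi> n)" and "inj \<phi>"
  shows "Cauchy_productive G T b"
  unfolding Cauchy_productive_def left_Cauchy_def
proof (intro conjI allI impI)
  let ?P = "ordered_prod G b"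
  have U_carrier: "U n \<subseteq> carrier G" for n
    using openin_subset[OF U_open] topspace_eq by simp
  show b: "range b \<subseteq> carrier G"
    using U_carrier b_mem by blast
  then have P: "?P n \<in> carrier G" for n
    by (rule ordered_prod_closed)
  then show "range ?P \<subseteq> carrier G"
    by blast
  fix W assume W: "\<one> \<in> T interior_of W"
  obtain N where N: "U N \<subseteq> W"
    using U_base[OF openin_interior_of W] interior_of_subset by (meson subset_trans)
  \<comment> \<open>Beyond the finitely many positions with \<open>\<phi> n \<le> N\<close>, every
    factor has index above \<open>N\<close>; \<open>k\<close> bounds these positions.\<close>
  have "finite (\<phi> -` {..N})"
    using \<open>inj \<phi>\<close> by (simp add: finite_vimageI)
  then obtain k where k: "\<And>n. n \<in> \<phi> -` {..N} \<Longrightarrow> n < k"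
    using finite_nat_set_iff_bounded by meson
  then have gt: "N < \<phi> n" if "k \<le> n" for n
    using that by (metis atMost_iff leD not_le vimageI2)
  have le: "inv (?P l) \<otimes> ?P m \<in> U N" if "k \<le> l" "l \<le> m" for l m
    using U_carrier one_mem U_triple b_mem \<open>inj \<phi>\<close> that(2)
    by (rule inv_ordered_prod_mult_mem) (use that gt in auto)
  have "inv (?P l) \<otimes> ?P m \<in> U N" if "k \<le> l" "k \<le> m" for l m
  proof (cases "l \<le> m")
    case True
    with that le show ?thesis
      by blast
  next
    case False
    \<comment> \<open>For \<open>m < l\<close> the quotient is the inverse of the one already
      treated, and \<open>U N\<close> is symmetric.\<close>
    then have "inv (inv (?P m) \<otimes> ?P l) \<in> U N"
      using U_inv le that by simp
    then show ?thesis
      using P by (simp add: inv_mult_group)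
  qed
  with N show "\<exists>k. \<forall>l\<ge>k. \<forall>m\<ge>k. inv (?P l) \<otimes> ?P m \<in> W"
    by blast
qed

lemma exists_unconditionally_f_Cauchy_productive:
  assumes "first_countable T" "T \<noteq> discrete_topology (carrier G)"
  shows "\<exists>a. unconditionally_f_Cauchy_productive G T f a"
proof -
  obtain U :: "nat \<Rightarrow> 'a set" where U:
    "\<And>n. openin T (U n)" "\<And>n. \<one> \<in> U n" "\<And>n x. x \<in> U n \<Longrightarrow> inv x \<in> U n"
    "\<And>n x y z. \<lbrakk>x \<in> U (Suc n); y \<in> U (Suc n); z \<in> U (Suc n)\<rbrakk> \<Longrightarrow> x \<otimes> y \<otimes> z \<in> U n"
    "\<And>W. \<lbrakk>openin T W; \<one> \<in> W\<rbrakk> \<Longrightarrow> \<exists>n. U n \<subseteq> W"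
    using exists_cubing_neighbourhood_base[OF assms(1)] by blast
  \<comment> \<open>Exponents are handled before any rearrangement: the choice of \<open>a n\<close>
    in \<open>V n\<close> depends neither on \<open>z\<close> nor on \<open>\<phi>\<close>.\<close>
  have "\<exists>V. openin T V \<and> \<one> \<in> V \<and> (\<forall>x\<in>V. \<forall>j. \<bar>j\<bar> \<le> int (f n) \<longrightarrow> x [^] j \<in> U n)" for n
    using exists_neighbourhood_powers[OF U(1,2)] by metis
  then obtain V where V: "\<And>n. openin T (V n)" "\<And>n. \<one> \<in> V n"
    "\<And>n x j. \<lbrakk>x \<in> V n; \<bar>j\<bar> \<le> int (f n)\<rbrakk> \<Longrightarrow> x [^] j \<in> U n"
    by metis
  obtain a where a: "inj a" "\<And>n. a n \<in> V n"
    using exists_inj_choice[of V] infinite_neighbourhood_one[OF assms(2) V(1,2)] by blast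
  have a_carrier: "a n \<in> carrier G" for n
    using a(2) openin_subset[OF V(1)] topspace_eq by blast
  have "f_Cauchy_productive G T (f \<circ> \<phi>) (\<lambda>n. a (\<phi> n))" if "bij \<phi>" for \<phi>
    unfolding f_Cauchy_productive_def
  proof (intro conjI allI impI)
    have "inj \<phi>"
      using that by (rule bij_is_inj)
    then show "inj (\<lambda>n. a (\<phi> n))"
      using a(1) by (simp add: inj_def)
    show "range (\<lambda>n. a (\<phi> n)) \<subseteq> carrier G"
      using a_carrier by blast
    fix z :: "nat \<Rightarrow> int" assume "\<forall>n. \<bar>z n\<bar> \<le> int ((f \<circ> \<phi>) n)"
    \<comment> \<open>The bound on \<open>z n\<close> is \<open>f (\<phi> n)\<close>, exactly the
      one built into \<open>V (\<phi> n)\<close>.\<close>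
    then have mem: "a (\<phi> n) [^] z n \<in> U (\<phi> n)" for n
      using V(3) a(2) by simp
    show "Cauchy_productive G T (\<lambda>n. a (\<phi> n) [^] z n)"
      by (rule Cauchy_productive_rearrangement[of U _ \<phi>]) (fact U mem \<open>inj \<phi>\<close>)+
  qed
  with a(1) a_carrier show ?thesis
    unfolding unconditionally_f_Cauchy_productive_def by blast
qed

end

theorem theorem5p3:
  fixes G :: "('a, 'b) monoid_scheme" and T :: "'a topology" and f :: "nat \<Rightarrow> nat"
  assumes "metric_group G T"
    and "T \<noteq> discrete_topology (carrier G)"
    and "\<forall>n. f n \<noteq> 0"
  shows "\<exists>a. unconditionally_f_Cauchy_productive G T f a"
proof -
  interpret metric_group G T
    by (rule assms(1))
  show ?thesis
    using metrizable_imp_first_countable[OF metrizable] assms(2)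
    by (rule exists_unconditionally_f_Cauchy_productive)
qed

end
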